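(* The operator $\mathcal{J}:\mathcal{C}(\mathbb{Z})\to\mathcal{C}(\mathbb{Z})$ given by $(\mathcal{J}f)_n:=\tau^{-\ell(w_n)}(I_{w_n}f)_{n_+}$ ($f\in\mathcal{C}(\mathbb{Z})$, $n\in\mathbb{Z}$) satisfies the intertwining relations $$\hat{T}\mathcal{J}=\mathcal{J}I,\quad u\mathcal{J}=\mathcal{J}u,\quad \hat{X}\mathcal{J}=\mathcal{J}D.$$
   Context: Fix $\tau\in(0,1)$ and an integer $M>1$. Affine Weyl group: $W=\langle s,u\mid s^2=u^2=1\rangle$, $s_1:=s$, $s_0:=usu$, $W_S:=\langle s_0,s_1\rangle$. Every $w\in W$ can be written uniquely as $w=u^{i_0}s_{i_1}\cdots s_{i_r}$ with $i_j\in\{0,1\}$ and $r\ge 0$ minimal (reduced expression); $\ell(w):=r$. Put $\eta(w):=\ell(ws)-\ell(w)\in\{1,-1\}$. For $v,w\in W$: $v<w$ iff $v^{-1}w\in W_S$ and $\ell(v)<\ell(w)$. $\mathcal{C}(\mathbb{Z})$ is the space of functions $f:\mathbb{Z}\to\mathbb{C}$, with $f_n:=f(n)$. $W$ acts on $\mathbb{Z}$ by $sn=-n$, $un=M-n$ and on $\mathcal{C}(\mathbb{Z})$ by $(wf)(n)=f(w^{-1}n)$. $\Lambda_M:=\{0,1,\dots,M\}$ is a fundamental domain for $W_S$ on $\mathbb{Z}$; $w_n$ denotes the unique shortest element of $W_S$ with $w_n n\in\Lambda_M$, and $n_+:=w_n n$. Convention: $\text{sign}(0)=0$. Operators on $\mathcal{C}(\mathbb{Z})$: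 (1) $(\hat Tf)_n=\tau f_{-n}$ if $n\ge0$ and $(\hat Tf)_n=\tau^{-1}f_{-n}+(\tau-\tau^{-1})f_n$ if $n<0$. (2) $$(\hat{X}f)_n := \tau^{(\ell (w_{n-1})-\ell (w_n))(1+\eta(w_{un}))}f_{n-1}+\text{sign}(n) \sum_{v\in W,\, v<w_n}\tau^{-(\ell (w_{n})-\ell (v))}a(\ell (w_{n})-\ell (v))\, f_{v(n-\text{sign}(n))_+},$$ where $f_{v(n-\text{sign}(n))_+}$ is the value of $f$ at the point obtained by applying $v$ to $(n-\text{sign}(n))_+$, and $a(k):=\frac{1-\tau^2}{1+\tau^2}\bigl(\tau^{-k}+(-1)^{k+1}\tau^k\bigr)$. (3) $(Df)_n:=f_{n-1}$. (4) $I:=\tau s+(\tau-\tau^{-1})J$, where $(Jf)_n:=-f_{n-2}-f_{n-4}-\dots-f_{-n}$ if $n>0$, $(Jf)_0:=0$, and $(Jf)_n:=f_n+f_{n+2}+\dots+f_{-n-2}$ if $n<0$ (steps of $2$, $|n|$ terms). (5) For $w\in W$ with reduced expression $w=u^{i_0}s_{i_1}\cdots s_{i_r}$, $I_w:=u^{i_0}I_{s_{i_1}}\cdots I_{s_{i_r}}$ with $I_{s_1}:=I$ and $I_{s_0}:=uIu$. *)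

theory Defs
  imports Complex_Main
begin

section \<open>The affine Weyl group\<close>

datatype weyl_gen = Gen_s | Gen_u

text \<open>The congruence on words over the two generators that is generated by \<open>x x = 1\<close>; the
  group \<open>\<langle>s, u | s\<^sup>2 = u\<^sup>2 = 1\<rangle>\<close> is the quotient.\<close>

inductive weyl_rel :: "weyl_gen list \<Rightarrow> weyl_gen list \<Rightarrow> bool" where
  cancel: "weyl_rel (xs @ [g, g] @ ys) (xs @ ys)"
| refl: "weyl_rel xs xs"
| sym: "weyl_rel xs ys \<Longrightarrow> weyl_rel ys xs"
| trans: "weyl_rel xs ys \<Longrightarrow> weyl_rel ys zs \<Longrightarrow> weyl_rel xs zs"

lemma weyl_rel_append_left: "weyl_rel xs ys \<Longrightarrow> weyl_rel (zs @ xs) (zs @ ys)"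
proof (induction rule: weyl_rel.induct)
  case (cancel xs g ys)
  show ?case using weyl_rel.cancel[of "zs @ xs" g ys] by simp
qed (auto intro: weyl_rel.intros)

lemma weyl_rel_append_right: "weyl_rel xs ys \<Longrightarrow> weyl_rel (xs @ zs) (ys @ zs)"
proof (induction rule: weyl_rel.induct)
  case (cancel xs g ys)
  show ?case using weyl_rel.cancel[of xs g "ys @ zs"] by simp
qed (auto intro: weyl_rel.intros)

lemma weyl_rel_rev: "weyl_rel xs ys \<Longrightarrow> weyl_rel (rev xs) (rev ys)"
proof (induction rule: weyl_rel.induct)
  case (cancel xs g ys)
  show ?case using weyl_rel.cancel[of "rev ys" g "rev xs"] by simp
qed (auto intro: weyl_rel.intros)

lemma weyl_rel_rev_append: "weyl_rel (rev xs @ xs) []"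
proof (induction xs)
  case (Cons g xs)
  have "weyl_rel (rev xs @ [g, g] @ xs) (rev xs @ xs)" by (rule weyl_rel.cancel)
  then show ?case using Cons weyl_rel.trans by force
qed (auto intro: weyl_rel.intros)

quotient_type weyl = "weyl_gen list" / weyl_rel
  by (rule equivpI) (auto intro!: reflpI sympI transpI intro: weyl_rel.intros)

instantiation weyl :: "{monoid_mult, inverse}"
begin

lift_definition one_weyl :: weyl is "[]" .

lift_definition times_weyl :: "weyl \<Rightarrow> weyl \<Rightarrow> weyl" is "(@)"
  by (meson weyl_rel.trans weyl_rel_append_left weyl_rel_append_right)

lift_definition inverse_weyl :: "weyl \<Rightarrow> weyl" is rev
  by (rule weyl_rel_rev)

definition divide_weyl :: "weyl \<Rightarrow> weyl \<Rightarrow> weyl" where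
  "divide_weyl v w = v * inverse w"

instance
  by standard (transfer, simp add: weyl_rel.refl)+

end

lemma weyl_left_inverse: "inverse w * w = (1 :: weyl)"
  by transfer (rule weyl_rel_rev_append)

lemma weyl_right_inverse: "w * inverse w = (1 :: weyl)"
  by transfer (metis rev_rev_ident weyl_rel_rev_append)

lift_definition weyl_s :: weyl is "[Gen_s]" .
lift_definition weyl_u :: weyl is "[Gen_u]" .

lemma weyl_involutions: "weyl_s * weyl_s = 1" "weyl_u * weyl_u = 1"
  by (transfer, metis append_Cons append_Nil weyl_rel.cancel)+

text \<open>\<open>simple_refl 0\<close> is \<open>s\<^sub>0 = u s u\<close> and \<open>simple_refl 1\<close> is \<open>s\<^sub>1 = s\<close>; the length below counts these letters
  only, so \<open>u\<close> has length zero.\<close>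

definition simple_refl :: "nat \<Rightarrow> weyl" where
  "simple_refl i = (if i = 0 then weyl_u * weyl_s * weyl_u else weyl_s)"

inductive_set W_S :: "weyl set" where
  one: "1 \<in> W_S"
| gen: "i \<in> {0, 1} \<Longrightarrow> simple_refl i \<in> W_S"
| mult: "v \<in> W_S \<Longrightarrow> w \<in> W_S \<Longrightarrow> v * w \<in> W_S"
| inv: "w \<in> W_S \<Longrightarrow> inverse w \<in> W_S"

definition is_expr :: "weyl \<Rightarrow> nat \<Rightarrow> nat list \<Rightarrow> bool" where
  "is_expr w i0 is \<longleftrightarrow>
     i0 \<in> {0, 1} \<and> set is \<subseteq> {0, 1} \<and> w = weyl_u ^ i0 * prod_list (map simple_refl is)"

definition weyl_length :: "weyl \<Rightarrow> nat" where
  "weyl_length w = (LEAST r. \<exists>i0 is. is_expr w i0 is \<and> length is = r)"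

definition is_reduced_expr :: "weyl \<Rightarrow> nat \<Rightarrow> nat list \<Rightarrow> bool" where
  "is_reduced_expr w i0 is \<longleftrightarrow> is_expr w i0 is \<and> length is = weyl_length w"

definition reduced_expr :: "weyl \<Rightarrow> nat \<times> nat list" where
  "reduced_expr w = (THE (i0, is). is_reduced_expr w i0 is)"

definition eta :: "weyl \<Rightarrow> int" where
  "eta w = int (weyl_length (w * weyl_s)) - int (weyl_length w)"

definition weyl_less :: "weyl \<Rightarrow> weyl \<Rightarrow> bool" where
  "weyl_less v w \<longleftrightarrow> inverse v * w \<in> W_S \<and> weyl_length v < weyl_length w"

section \<open>Actions on the integers and on functions\<close>

primrec gen_act :: "int \<Rightarrow> weyl_gen \<Rightarrow> int \<Rightarrow> int" where
  "gen_act M Gen_s n = - n"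
| "gen_act M Gen_u n = M - n"

lemma gen_act_gen_act: "gen_act M g (gen_act M g n) = n"
  by (cases g) auto

lemma foldr_gen_act_cong:
  "weyl_rel xs ys \<Longrightarrow> foldr (gen_act M) xs n = foldr (gen_act M) ys n"
  by (induction rule: weyl_rel.induct) (auto simp: gen_act_gen_act)

lift_definition act :: "int \<Rightarrow> weyl \<Rightarrow> int \<Rightarrow> int" is "\<lambda>M xs n. foldr (gen_act M) xs n"
  by (rule ext) (rule foldr_gen_act_cong)

lemma act_simps:
  "act M weyl_s n = - n" "act M weyl_u n = M - n" "act M 1 n = n"
  "act M (v * w) n = act M v (act M w n)"
  by (transfer, simp)+

definition fun_act :: "int \<Rightarrow> weyl \<Rightarrow> (int \<Rightarrow> complex) \<Rightarrow> (int \<Rightarrow> complex)" where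
  "fun_act M w f = (\<lambda>n. f (act M (inverse w) n))"

text \<open>\<open>shortest_to_dom M n\<close> is \<open>w\<^sub>n\<close>, the unique shortest element of \<open>W_S\<close> moving \<open>n\<close> into the
  fundamental domain \<open>{0..M}\<close>, and \<open>dom_rep M n\<close> is \<open>n\<^sub>+ = w\<^sub>n n\<close>.\<close>

definition shortest_to_dom :: "int \<Rightarrow> int \<Rightarrow> weyl" where
  "shortest_to_dom M n = (THE w. is_arg_min weyl_length (\<lambda>w. w \<in> W_S \<and> act M w n \<in> {0..M}) w)"

definition dom_rep :: "int \<Rightarrow> int \<Rightarrow> int" where
  "dom_rep M n = act M (shortest_to_dom M n) n"

section \<open>The operators\<close>

text \<open>The sum in \<open>X_hat\<close> runs over a finite set, as there are only finitely many elements of bounded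
  length.\<close>

definition T_hat :: "real \<Rightarrow> (int \<Rightarrow> complex) \<Rightarrow> (int \<Rightarrow> complex)" where
  "T_hat \<tau> f = (\<lambda>n.
     if n \<ge> 0 then of_real \<tau> * f (- n)
     else of_real (inverse \<tau>) * f (- n) + of_real (\<tau> - inverse \<tau>) * f n)"

definition a_coeff :: "real \<Rightarrow> int \<Rightarrow> real" where
  "a_coeff \<tau> k = (1 - \<tau>\<^sup>2) / (1 + \<tau>\<^sup>2) * (\<tau> powi (- k) + (- 1) powi (k + 1) * \<tau> powi k)"

definition X_hat :: "real \<Rightarrow> int \<Rightarrow> (int \<Rightarrow> complex) \<Rightarrow> (int \<Rightarrow> complex)" where
  "X_hat \<tau> M f = (\<lambda>n.
     let w = shortest_to_dom M; len = (\<lambda>v. int (weyl_length v)) in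
     of_real (\<tau> powi ((len (w (n - 1)) - len (w n)) * (1 + eta (w (act M weyl_u n))))) * f (n - 1)
     + of_int (sgn n) *
       (\<Sum>v | weyl_less v (w n).
          of_real (\<tau> powi (- (len (w n) - len v)) * a_coeff \<tau> (len (w n) - len v))
            * f (act M v (dom_rep M (n - sgn n)))))"

definition D_op :: "(int \<Rightarrow> complex) \<Rightarrow> (int \<Rightarrow> complex)" where
  "D_op f = (\<lambda>n. f (n - 1))"

definition J_op :: "(int \<Rightarrow> complex) \<Rightarrow> (int \<Rightarrow> complex)" where
  "J_op f = (\<lambda>n.
     if n > 0 then - (\<Sum>j = 1..nat n. f (n - 2 * int j))
     else if n = 0 then 0
     else (\<Sum>j < nat (- n). f (n + 2 * int j)))"

definition I_op :: "real \<Rightarrow> int \<Rightarrow> (int \<Rightarrow> complex) \<Rightarrow> (int \<Rightarrow> complex)" where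
  "I_op \<tau> M f = (\<lambda>n.
     of_real \<tau> * fun_act M weyl_s f n + of_real (\<tau> - inverse \<tau>) * J_op f n)"

definition I_refl :: "real \<Rightarrow> int \<Rightarrow> nat \<Rightarrow> (int \<Rightarrow> complex) \<Rightarrow> (int \<Rightarrow> complex)" where
  "I_refl \<tau> M i =
     (if i = 0 then fun_act M weyl_u \<circ> I_op \<tau> M \<circ> fun_act M weyl_u else I_op \<tau> M)"

definition I_weyl :: "real \<Rightarrow> int \<Rightarrow> weyl \<Rightarrow> (int \<Rightarrow> complex) \<Rightarrow> (int \<Rightarrow> complex)" where
  "I_weyl \<tau> M w =
     (case reduced_expr w of (i0, is) \<Rightarrow>
        fun_act M (weyl_u ^ i0) \<circ> foldr (\<circ>) (map (I_refl \<tau> M) is) id)"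

definition intertwiner :: "real \<Rightarrow> int \<Rightarrow> (int \<Rightarrow> complex) \<Rightarrow> (int \<Rightarrow> complex)" where
  "intertwiner \<tau> M f = (\<lambda>n.
     let w = shortest_to_dom M n in
     of_real (\<tau> powi (- int (weyl_length w))) * I_weyl \<tau> M w f (dom_rep M n))"

end

theory Submission
  imports Defs
begin

text \<open>
  The elements of \<open>W\<^sub>S\<close> are indexed by the chambers \<open>{c * M..(c + 1) * M}\<close>: the element for \<open>c\<close> has
  length \<open>\<bar>c\<bar>\<close> and moves the chamber back to \<open>{0..M}\<close>. Hence \<open>w\<^sub>n\<close> is read off the chamber of \<open>n\<close>. The operators
  \<open>T i\<close> attached to \<open>s\<^sub>i\<close> satisfy the Hecke relation \<open>T\<^sup>2 = q T + 1\<close>, \<open>q = \<tau> - 1 / \<tau>\<close>, because \<open>J\<close> is idempotent, odd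
  and \<open>J s = J + s - 1\<close>. This gives the relation for \<open>T_hat\<close>; the one for \<open>u\<close> is a symmetry.

  For \<open>X_hat\<close>, the rule \<open>T\<^sub>1\<^sup>-\<^sup>1 D = D\<^sup>-\<^sup>1 T\<^sub>1\<close> and its conjugate by \<open>u\<close> show that moving \<open>D\<close> to the left
  through \<open>T\<^sub>w\<close> turns \<open>T\<^sub>w\<close> into the inverse of \<open>T\<close> at \<open>w\<^sup>-\<^sup>1\<close> (for \<open>n > 0\<close>), or splits off the difference of that
  inverse and \<open>T\<^sub>w\<close> (for \<open>n \<le> 0\<close>). In a dihedral group this inverse is \<open>T\<^sub>w + (\<Sum>v<w. a (\<ell> w - \<ell> v) T\<^sub>v)\<close>, because
  \<open>a (k + 2) = a k - q a (k + 1)\<close>, \<open>a 0 = 0\<close> and \<open>a 1 = - q\<close>. The values \<open>(T\<^sub>v f) m\<close> for \<open>m \<in> {0..M}\<close> are values of the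
  intertwiner at points of the orbit of \<open>m\<close>.
\<close>

section \<open>Chambers and the affine Weyl group\<close>

lemma inverse_weyl_u: "inverse weyl_u = weyl_u"
  by transfer (simp add: weyl_rel.refl)

lemma inverse_weyl_s: "inverse weyl_s = weyl_s"
  by transfer (simp add: weyl_rel.refl)

lemma inverse_weyl_mult: "inverse (v * w) = inverse w * inverse (v :: weyl)"
  by transfer (simp add: weyl_rel.refl)

lemma inverse_weyl_one: "inverse (1 :: weyl) = 1"
  by transfer (simp add: weyl_rel.refl)

lemma inverse_inverse_weyl: "inverse (inverse w) = (w :: weyl)"
  by transfer (simp add: weyl_rel.refl)

lemma inverse_simple_refl: "inverse (simple_refl i) = simple_refl i"
  by (simp add: simple_refl_def inverse_weyl_mult inverse_weyl_u inverse_weyl_s mult.assoc)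

lemma simple_refl_square: "simple_refl i * simple_refl i = 1"
  using weyl_left_inverse[of "simple_refl i"] by (simp add: inverse_simple_refl)

lemma simple_refl_cancel: "simple_refl i * (simple_refl i * w) = w"
  by (metis mult.assoc mult_1 simple_refl_square)

lemma act_simple_refl: "act M (simple_refl i) n = (if i = 0 then 2 * M - n else - n)"
  by (simp add: simple_refl_def act_simps)

lemma act_inverse: "act M w (act M (inverse w) n) = n" "act M (inverse w) (act M w n) = n"
  by (metis act_simps(3,4) weyl_left_inverse weyl_right_inverse)+

text \<open>The alternating word of length \<open>k\<close> that ends in \<open>b\<close>. The recursion prepends letters, so that \<open>alt 0\<close> and
  \<open>alt 1\<close> list the elements that take the chambers right and left of the origin back to \<open>{0..M}\<close>.\<close>

fun alt :: "nat \<Rightarrow> nat \<Rightarrow> nat list" where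
  "alt b 0 = []"
| "alt b (Suc k) = ((b + k) mod 2) # alt b k"

definition chamber_elt :: "int \<Rightarrow> weyl" where
  "chamber_elt c =
     prod_list (map simple_refl (alt (if c \<ge> 0 then 0 else 1) (nat \<bar>c\<bar>)))"

section \<open>Alternating words, lengths and reduced expressions\<close>

lemma length_alt [simp]: "length (alt b k) = k"
  by (induction k) auto

lemma set_alt: "set (alt b k) \<subseteq> {0, 1}"
  by (induction k) auto

lemma alt_snoc: "alt 1 (Suc k) = alt 0 k @ [1]" "alt 0 (Suc k) = alt 1 k @ [0]"
proof -
  show "alt 1 (Suc k) = alt 0 k @ [1]" by (induction k) auto
  show "alt 0 (Suc k) = alt 1 k @ [0]"
  proof (induction k)
    case (Suc k)
    then show ?case by (auto simp: mod_Suc)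
  qed simp
qed

text \<open>The two reflections compose to a translation by \<open>2 * M\<close>, so even words
  translate and odd words reflect.\<close>

lemma act_alt:
  "act M (prod_list (map simple_refl (alt 0 k))) n
     = (if even k then n - int k * M else (int k + 1) * M - n)"
  "act M (prod_list (map simple_refl (alt 1 k))) n
     = (if even k then n + int k * M else (1 - int k) * M - n)"
  by (induction k) (auto simp: act_simps act_simple_refl algebra_simps mod_Suc)

lemma act_chamber_elt:
  "act M (chamber_elt c) n = (if even c then n - c * M else (c + 1) * M - n)"
proof (cases "c \<ge> 0")
  case True
  then show ?thesis using act_alt(1)[of M "nat c" n] 
    by (simp add: chamber_elt_def even_nat_iff)
next
  case False
  then show ?thesis using act_alt(2)[of M "nat (- c)" n]
    by (simp add: chamber_elt_def even_nat_iff)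
qed

text \<open>For \<open>M = 1\<close> the reflections preserve parity while \<open>u\<close> reverses
  it. This separates \<open>W_S\<close> from its other coset and forces \<open>i0 = 0\<close> in
  reduced expressions.\<close>

lemma even_act_W_S: "w \<in> W_S \<Longrightarrow> even (act 1 w n) = even n"
proof (induction arbitrary: n rule: W_S.induct)
  case (inv w)
  then show ?case by (metis act_inverse(1))
qed (auto simp: act_simps act_simple_refl)

lemma prod_list_in_W_S: "set is \<subseteq> {0, 1} \<Longrightarrow> prod_list (map simple_refl is) \<in> W_S"
proof (induction "is")
  case (Cons i "is")
  then show ?case using W_S.mult[OF W_S.gen[of i]] by simp
qed (simp add: W_S.one)

lemma chamber_elt_in_W_S: "chamber_elt c \<in> W_S"
  unfolding chamber_elt_def by (intro prod_list_in_W_S set_alt)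

text \<open>A letter put in front of an alternating word either continues the alternation or cancels
  against the first letter.\<close>

lemma alt_or_shorter:
  assumes "set is \<subseteq> {0, 1}"
  shows "(\<exists>b \<in> {0, 1}. is = alt b (length is)) \<or>
    (\<exists>js. set js \<subseteq> {0, 1} \<and> length js < length is \<and>
       prod_list (map simple_refl js) = prod_list (map simple_refl is))"
  using assms
proof (induction "is")
  case (Cons i "is")
  then have i: "i \<in> {0, 1}" by simp
  consider (alt) b where "b \<in> {0, 1}" "is = alt b (length is)"
    | (short) js where "set js \<subseteq> {0, 1}" "length js < length is"
        "prod_list (map simple_refl js) = prod_list (map simple_refl is)"
    using Cons by auto
  then show ?case
  proof cases
    case short
    then have "set (i # js) \<subseteq> {0, 1} \<and> length (i # js) < length (i # is) \<and>
       prod_list (map simple_refl (i # js)) = prod_list (map simple_refl (i # is))"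
      using i by simp
    then show ?thesis by blast
  next
    case alt
    show ?thesis
    proof (cases "is")
      case Nil
      then have "i # is = alt i (length (i # is))" using i by auto
      then show ?thesis using i by blast
    next
      case (Cons j js)
      have js: "j = (b + length js) mod 2" "js = alt b (length js)"
        using alt(2) by (simp_all add: Cons)
      show ?thesis
      proof (cases "i = j")
        case True
        have "set js \<subseteq> {0, 1}" using js(2) set_alt by metis
        then show ?thesis
          using True Cons by (intro disjI2 exI[of _ js]) (simp add: simple_refl_cancel)
      next
        case False
        have "i = (b + length is) mod 2"
          using False i js(1) Cons by (auto simp: mod_Suc split: if_splits)
        then have "i # is = alt b (length (i # is))" using alt(2) by simp
        then show ?thesis using alt(1) by blast
      qed
    qed
  qed
qed auto

lemma prod_list_eq_alt:
  assumes "set is \<subseteq> {0, 1}"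
  shows "\<exists>b \<in> {0, 1}. \<exists>k \<le> length is.
    prod_list (map simple_refl is) = prod_list (map simple_refl (alt b k))"
  using assms
proof (induction "length is" arbitrary: "is" rule: less_induct)
  case less
  show ?case
    using alt_or_shorter[OF less.prems]
  proof (elim disjE exE conjE)
    assume "\<exists>b \<in> {0, 1}. is = alt b (length is)"
    then show ?thesis by (metis order_refl)
  next
    fix js
    assume "set js \<subseteq> {0, 1}" "length js < length is"
      and eq: "prod_list (map simple_refl js) = prod_list (map simple_refl is)"
    with less.hyps[of js] show ?thesis by (metis le_trans less_imp_le)
  qed
qed

lemma alt_eq_chamber_elt:
  assumes "b \<in> {0, 1}"
  shows "prod_list (map simple_refl (alt b k)) = chamber_elt (if b = 0 then int k else - int k)"
  using assms by (auto simp: chamber_elt_def)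

lemma W_S_eq: "W_S = range chamber_elt"
proof (intro equalityI subsetI)
  fix w assume "w \<in> W_S"
  then have "\<exists>is. set is \<subseteq> {0, 1} \<and> w = prod_list (map simple_refl is)"
  proof (induction rule: W_S.induct)
    case one
    show ?case by (intro exI[of _ "[]"]) simp
  next
    case (gen i)
    then show ?case by (intro exI[of _ "[i]"]) simp
  next
    case (mult v w)
    then obtain "is" js where "set is \<subseteq> {0, 1}" "v = prod_list (map simple_refl is)"
      "set js \<subseteq> {0, 1}" "w = prod_list (map simple_refl js)" by blast
    then show ?case by (intro exI[of _ "is @ js"]) simp
  next
    case (inv w)
    then obtain "is" where "is": "set is \<subseteq> {0, 1}" "w = prod_list (map simple_refl is)" by blast
    have "inverse (prod_list (map simple_refl is)) = prod_list (map simple_refl (rev is))"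
      by (induction "is") (simp_all add: inverse_weyl_one inverse_weyl_mult inverse_simple_refl)
    with "is" show ?case by (intro exI[of _ "rev is"]) simp
  qed
  then obtain b k where "b \<in> {0, 1 :: nat}" "w = prod_list (map simple_refl (alt b k))"
    using prod_list_eq_alt by metis
  then show "w \<in> range chamber_elt" by (simp add: alt_eq_chamber_elt)
qed (auto intro: chamber_elt_in_W_S)

text \<open>For \<open>M = 2\<close> the point \<open>1\<close> is the midpoint of the fundamental domain, so its orbit under \<open>W_S\<close>
  is free; moreover \<open>u\<close> fixes it.\<close>

lemma W_S_eqI:
  assumes "v \<in> W_S" "w \<in> W_S" "act 2 v 1 = act 2 w 1"
  shows "v = w"
proof -
  obtain c d where "v = chamber_elt c" "w = chamber_elt d"
    using assms(1,2) unfolding W_S_eq by blast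
  moreover from this have "c = d"
    using assms(3) by (auto simp: act_chamber_elt split: if_splits; presburger)
  ultimately show ?thesis by simp
qed

lemma inj_chamber_elt: "inj chamber_elt"
proof
  fix c d assume "chamber_elt c = chamber_elt d"
  then have "act 2 (chamber_elt c) 1 = act 2 (chamber_elt d) 1" by simp
  then show "c = d" by (auto simp: act_chamber_elt split: if_splits; presburger)
qed

text \<open>For \<open>M = 2\<close>, \<open>u\<close> fixes the point 1 and each reflection changes
  the distance to 1 by at most 2. Alternating words attain this bound, which makes them
  reduced.\<close>

lemma act_expr_bound:
  assumes "is_expr w i0 is"
  shows "\<bar>act 2 w 1 - 1\<bar> \<le> 2 * int (length is)"
proof -
  have "\<bar>act 2 (prod_list (map simple_refl is)) 1 - 1\<bar> \<le> 2 * int (length is)"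
    by (induction "is") (auto simp: act_simps act_simple_refl)
  then show ?thesis using assms by (auto simp: is_expr_def act_simps)
qed

lemma is_expr_alt:
  assumes "b \<in> {0, 1}"
  shows "is_expr (prod_list (map simple_refl (alt b k))) 0 (alt b k)"
  using set_alt by (auto simp: is_expr_def)

lemma weyl_length_alt:
  assumes "b \<in> {0, 1}"
  shows "weyl_length (prod_list (map simple_refl (alt b k))) = k"
  unfolding weyl_length_def
proof (rule Least_equality)
  show "\<exists>i0 is. is_expr (prod_list (map simple_refl (alt b k))) i0 is \<and> length is = k"
    using is_expr_alt[OF assms] length_alt by blast
next
  fix r assume "\<exists>i0 is. is_expr (prod_list (map simple_refl (alt b k))) i0 is \<and> length is = r"
  then have "\<bar>act 2 (prod_list (map simple_refl (alt b k))) 1 - 1\<bar> \<le> 2 * int r"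
    using act_expr_bound by blast
  then show "k \<le> r" using assms
    by (auto simp: act_alt simp del: One_nat_def split: if_splits)
qed

lemma weyl_length_chamber_elt: "weyl_length (chamber_elt c) = nat \<bar>c\<bar>"
  unfolding chamber_elt_def by (rule weyl_length_alt) simp

lemma reduced_expr_alt:
  assumes b: "b \<in> {0, 1}"
  shows "reduced_expr (prod_list (map simple_refl (alt b k))) = (0, alt b k)"
  unfolding reduced_expr_def
proof (rule the_equality)
  let ?w = "prod_list (map simple_refl (alt b k))"
  show "case (0, alt b k) of (i0, is) \<Rightarrow> is_reduced_expr ?w i0 is"
    using b by (simp add: is_reduced_expr_def is_expr_alt weyl_length_alt)
  fix p assume "case p of (i0, is) \<Rightarrow> is_reduced_expr ?w i0 is"
  then obtain i0 "is" where p: "p = (i0, is)" and expr: "is_expr ?w i0 is" and len: "length is = k"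
    using b by (cases p) (auto simp: is_reduced_expr_def weyl_length_alt)
  have is01: "set is \<subseteq> {0, 1}" and i01: "i0 \<in> {0, 1}"
    and w: "?w = weyl_u ^ i0 * prod_list (map simple_refl is)"
    using expr by (simp_all add: is_expr_def)
  have "even (act 1 ?w 0)"
    using even_act_W_S[OF prod_list_in_W_S[OF set_alt]] by simp
  moreover have "even (act 1 (prod_list (map simple_refl is)) 0)"
    using even_act_W_S[OF prod_list_in_W_S[OF is01]] by simp
  ultimately have i0: "i0 = 0"
    using i01 unfolding w by (auto simp: act_simps)
  then have w': "?w = prod_list (map simple_refl is)" using w by simp
  have "\<not> (\<exists>js. set js \<subseteq> {0, 1} \<and> length js < k \<and>
       prod_list (map simple_refl js) = prod_list (map simple_refl is))"
  proof
    assume "\<exists>js. set js \<subseteq> {0, 1} \<and> length js < k \<and>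
       prod_list (map simple_refl js) = prod_list (map simple_refl is)"
    then obtain js where js: "set js \<subseteq> {0, 1}" "length js < k"
        "prod_list (map simple_refl js) = prod_list (map simple_refl is)"
      by blast
    then have "is_expr ?w 0 js" using w' by (simp add: is_expr_def)
    then have "weyl_length ?w \<le> length js"
      unfolding weyl_length_def by (intro Least_le) blast
    then show False using js(2) b by (simp add: weyl_length_alt)
  qed
  then obtain b' where b': "b' \<in> {0, 1}" "is = alt b' k"
    using alt_or_shorter[OF is01] unfolding len by blast
  have "alt b k = alt b' k"
  \<comment> \<open>For \<open>k > 0\<close> different last letters would give chambers of opposite
    sign, contradicting injectivity.\<close>
  proof (cases "k = 0")
    case False
    have "chamber_elt (if b = 0 then int k else - int k)
        = chamber_elt (if b' = 0 then int k else - int k)"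
      using w' b b' by (metis alt_eq_chamber_elt)
    then show ?thesis using False b b'(1) injD[OF inj_chamber_elt] by fastforce
  qed simp
  then show "p = (0, alt b k)" using p i0 b' by simp
qed

text \<open>Even chambers belong to translations, odd ones to reflections, which are
  involutions.\<close>

lemma inverse_chamber_elt:
  "inverse (chamber_elt c) = chamber_elt (if even c then - c else c)"
proof (rule W_S_eqI)
  have "act 2 (chamber_elt c) (act 2 (inverse (chamber_elt c)) 1) = 1"
    by (rule act_inverse)
  then show "act 2 (inverse (chamber_elt c)) 1 = act 2 (chamber_elt (if even c then - c else c)) 1"
    by (auto simp: act_chamber_elt split: if_splits)
qed (auto intro: W_S.inv chamber_elt_in_W_S)

text \<open>Negation maps the chamber \<open>c\<close> to the chamber \<open>- 1 - c\<close>;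
  comparing the two lengths yields \<open>eta\<close>.\<close>

lemma chamber_elt_mult_s: "chamber_elt c * weyl_s = chamber_elt (- 1 - c)"
proof (rule W_S_eqI)
  show "chamber_elt c * weyl_s \<in> W_S"
    using W_S.mult[OF chamber_elt_in_W_S W_S.gen[of 1]] by (simp add: simple_refl_def)
qed (auto simp: chamber_elt_in_W_S act_simps act_chamber_elt)

lemma eta_chamber_elt: "eta (chamber_elt c) = (if c \<ge> 0 then 1 else - 1)"
  by (simp add: eta_def chamber_elt_mult_s weyl_length_chamber_elt)

lemma weyl_less_chamber_elt:
  "{v. weyl_less v (chamber_elt c)} = chamber_elt ` {- \<bar>c\<bar> <..< \<bar>c\<bar>}"
proof -
  have "v \<in> W_S" if "inverse v * chamber_elt c \<in> W_S" for v
  proof -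
    have "chamber_elt c * inverse (inverse v * chamber_elt c) = v"
      by (metis inverse_inverse_weyl inverse_weyl_mult mult.assoc mult_1 weyl_right_inverse)
    with that show ?thesis by (metis W_S.inv W_S.mult chamber_elt_in_W_S)
  qed
  then have "weyl_less v (chamber_elt c) \<longleftrightarrow> v \<in> W_S \<and> weyl_length v < nat \<bar>c\<bar>" for v
    by (auto simp: weyl_less_def weyl_length_chamber_elt intro: W_S.intros chamber_elt_in_W_S)
  then show ?thesis
    by (auto simp: W_S_eq weyl_length_chamber_elt image_iff abs_less_iff)
qed

text \<open>The chamber \<open>{c * M..(c + 1) * M}\<close> containing \<open>n\<close>; a point on a wall is assigned to the chamber nearer
  to the origin.\<close>

definition chamber :: "int \<Rightarrow> int \<Rightarrow> int" where
  "chamber M n = (if n > 0 then (n - 1) div M else n div M)"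

text \<open>The origin is singled out because chamber 0 is the only one that keeps both of its
  walls.\<close>

lemma chamber_eqI:
  assumes "c \<ge> 0 \<Longrightarrow> n = 0 \<and> c = 0 \<or> c * M < n \<and> n \<le> (c + 1) * M"
    and "c < 0 \<Longrightarrow> c * M \<le> n \<and> n < (c + 1) * M" and "M > 0"
  shows "chamber M n = c"
proof (cases "c \<ge> 0")
  case True
  show ?thesis
  proof (cases "n = 0 \<and> c = 0")
    case False
    with assms(1)[OF True] have *: "c * M < n" "n \<le> (c + 1) * M" by auto
    moreover have "0 \<le> c * M" using True assms(3) by simp
    ultimately have "(n - 1) div M = c"
      by (intro int_div_pos_eq[of _ _ _ "n - 1 - c * M"]) (auto simp: algebra_simps)
    then show ?thesis using * \<open>0 \<le> c * M\<close> by (simp add: chamber_def)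
  qed (simp add: chamber_def)
next
  case False
  with assms(2) have *: "c * M \<le> n" "n < (c + 1) * M" by auto
  moreover have "(c + 1) * M \<le> 0" using False assms(3) by (simp add: mult_nonpos_nonneg)
  moreover have "n div M = c"
    using * by (intro int_div_pos_eq[of _ _ _ "n - c * M"]) (auto simp: algebra_simps)
  ultimately show ?thesis by (simp add: chamber_def)
qed

lemma chamber_bounds:
  assumes "M > 0"
  shows "n > 0 \<Longrightarrow> chamber M n \<ge> 0 \<and> chamber M n * M < n \<and> n \<le> (chamber M n + 1) * M"
    and "n \<le> 0 \<Longrightarrow> chamber M n \<le> 0 \<and> chamber M n * M \<le> n \<and> n < (chamber M n + 1) * M"
    and "n < 0 \<Longrightarrow> chamber M n < 0"
proof -
  have m: "a div M * M \<le> a \<and> a < (a div M + 1) * M" for a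
    using pos_mod_bound[OF assms, of a] pos_mod_sign[OF assms, of a] div_mult_mod_eq[of a M]
    unfolding distrib_right mult_1 by linarith
  show "n > 0 \<Longrightarrow> chamber M n \<ge> 0 \<and> chamber M n * M < n \<and> n \<le> (chamber M n + 1) * M"
    using m[of "n - 1"] assms by (simp add: chamber_def pos_imp_zdiv_nonneg_iff)
  show "n < 0 \<Longrightarrow> chamber M n < 0"
    using assms by (simp add: chamber_def pos_imp_zdiv_neg_iff)
  then show "n \<le> 0 \<Longrightarrow> chamber M n \<le> 0 \<and> chamber M n * M \<le> n \<and> n < (chamber M n + 1) * M"
    using m[of n] assms by (cases "n = 0") (auto simp: chamber_def)
qed

lemma act_chamber_elt_in_dom_iff:
  "act M (chamber_elt c) n \<in> {0..M} \<longleftrightarrow> c * M \<le> n \<and> n \<le> (c + 1) * M"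
  by (auto simp: act_chamber_elt algebra_simps)

text \<open>The wall convention selects the adjacent chamber of least absolute index, hence the
  shortest element.\<close>

lemma abs_chamber_le:
  assumes "M > 0" "d * M \<le> n" "n \<le> (d + 1) * M" "d \<noteq> chamber M n"
  shows "\<bar>chamber M n\<bar> < \<bar>d\<bar>"
proof -
  let ?c = "chamber M n"
  show ?thesis
  proof (cases "n > 0")
    case True
    then have c: "?c \<ge> 0" "?c * M < n" "n \<le> (?c + 1) * M" using chamber_bounds(1)[OF assms(1)] by auto
    have "?c * M < (d + 1) * M" using c assms by linarith
    then have "?c < d + 1" using assms(1) mult_less_cancel_right_pos by blast
    then show ?thesis using c(1) assms(4) by simp
  next
    case False
    then have c: "?c \<le> 0" "?c * M \<le> n" "n < (?c + 1) * M" using chamber_bounds(2)[OF assms(1)] by auto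
    have "d * M < (?c + 1) * M" using c assms by linarith
    then have "d < ?c + 1" using assms(1) mult_less_cancel_right_pos by blast
    then show ?thesis using c(1) assms(4) by simp
  qed
qed

lemma shortest_to_dom_eq:
  assumes "M > 0"
  shows "shortest_to_dom M n = chamber_elt (chamber M n)"
proof -
  let ?P = "\<lambda>w. w \<in> W_S \<and> act M w n \<in> {0..M}"
  let ?w = "chamber_elt (chamber M n)"
  have in_dom: "act M ?w n \<in> {0..M}"
    unfolding act_chamber_elt_in_dom_iff
    using chamber_bounds[OF assms, of n] by (cases "n > 0") auto
  have shorter: "weyl_length ?w < weyl_length w" if "?P w" "w \<noteq> ?w" for w
  proof -
    from that(1) obtain d where d: "w = chamber_elt d" using W_S_eq by auto
    with that have "d * M \<le> n" "n \<le> (d + 1) * M" "d \<noteq> chamber M n"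
      using act_chamber_elt_in_dom_iff by auto
    from abs_chamber_le[OF assms this] show ?thesis
      by (simp add: d weyl_length_chamber_elt)
  qed
  show ?thesis
    unfolding shortest_to_dom_def
  proof (rule the_equality)
    show "is_arg_min weyl_length ?P ?w"
      unfolding is_arg_min_def using in_dom chamber_elt_in_W_S shorter
      by (metis less_imp_not_less)
    show "w = ?w" if "is_arg_min weyl_length ?P w" for w
      using that shorter in_dom chamber_elt_in_W_S unfolding is_arg_min_def by blast
  qed
qed

text \<open>A point of two closed chambers lies on their common wall. The two cases are the walls to
  the right of the origin and those at or to the left of it.\<close>

lemma wall_cases:
  assumes "M > 0" "d * M \<le> n" "n \<le> (d + 1) * M" "d \<noteq> chamber M n"
  obtains "d > 0" "n = d * M" "chamber M n = d - 1"
    | "d < 0" "n = (d + 1) * M" "chamber M n = d + 1"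
proof -
  let ?c = "chamber M n"
  have less: "a < b" if "a * M < b * M" for a b :: int
    using that assms(1) mult_less_cancel_right_pos by blast
  have lt: "\<bar>?c\<bar> < \<bar>d\<bar>" using abs_chamber_le[OF assms] .
  show thesis
  proof (cases "n > 0")
    case True
    then have c: "?c \<ge> 0" "?c * M < n" "n \<le> (?c + 1) * M"
      using chamber_bounds(1)[OF assms(1)] by auto
    have "?c < d + 1" using less[of ?c "d + 1"] c assms by linarith
    then have d: "d > 0" "?c \<le> d - 1" using c(1) lt by auto
    have "\<not> ?c < d - 1"
    proof
      assume "?c < d - 1"
      then have "(?c + 1) * M < d * M" using assms(1) by simp
      then show False using c assms by linarith
    qed
    then have "?c = d - 1" using d by simp
    moreover from this have "n = d * M" using c(3) assms(2) by simp
    ultimately show thesis using that(1) d(1) by blast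
  next
    case False
    then have c: "?c \<le> 0" "?c * M \<le> n" "n < (?c + 1) * M"
      using chamber_bounds(2)[OF assms(1)] by auto
    have "d < ?c + 1" using less[of d "?c + 1"] c assms by linarith
    then have d: "d < 0" "d + 1 \<le> ?c" using c(1) lt assms(4) by auto
    have "\<not> d + 1 < ?c"
    proof
      assume "d + 1 < ?c"
      then have "(d + 1) * M < ?c * M" using assms(1) by simp
      then show False using c assms by linarith
    qed
    then have "?c = d + 1" using d by simp
    moreover from this have "n = (d + 1) * M" using c(2) assms(3) by simp
    ultimately show thesis using that(2) d(1) by blast
  qed
qed

lemma chamber_reflect:
  assumes "M > 0"
  shows "chamber M (M - n) = - chamber M n"
proof (cases "n > 0")
  case True
  then show ?thesis
    using chamber_bounds(1)[OF assms, of n] assms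
    by (intro chamber_eqI) (auto simp: algebra_simps)
next
  case False
  then show ?thesis
    using chamber_bounds(2)[OF assms, of n] assms
    by (intro chamber_eqI) (auto simp: algebra_simps)
qed

text \<open>The origin is excluded: it stays in chamber 0 under negation.\<close>

lemma chamber_minus:
  assumes "M > 0" "n \<noteq> 0"
  shows "chamber M (- n) = - 1 - chamber M n"
proof (cases "n > 0")
  case True
  then show ?thesis
    using chamber_bounds(1)[OF assms(1), of n] assms
    by (intro chamber_eqI) (auto simp: algebra_simps)
next
  case False
  then have "n < 0" using assms(2) by simp
  then show ?thesis
    using chamber_bounds(2,3)[OF assms(1), of n] assms
    by (intro chamber_eqI) (auto simp: algebra_simps)
qed

text \<open>The elements of two adjacent chambers agree on the common wall, so the choice of chamber
  does not matter there.\<close>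

lemma dom_rep_eq:
  assumes "M > 0" "d * M \<le> n" "n \<le> (d + 1) * M"
  shows "dom_rep M n = act M (chamber_elt d) n"
proof (cases "d = chamber M n")
  case True
  then show ?thesis by (simp add: dom_rep_def shortest_to_dom_eq[OF assms(1)])
next
  case False
  from wall_cases[OF assms False] show ?thesis
  proof cases
    case 1
    show ?thesis
      unfolding dom_rep_def shortest_to_dom_eq[OF assms(1)] 1(3)
      by (simp add: act_chamber_elt 1(2) algebra_simps)
  next
    case 2
    show ?thesis
      unfolding dom_rep_def shortest_to_dom_eq[OF assms(1)] 2(3)
      by (simp add: act_chamber_elt 2(2) algebra_simps)
  qed
qed

lemma sum_symmetric_interval:
  fixes F :: "int \<Rightarrow> 'a :: ab_group_add"
  shows "(\<Sum>d\<in>{- int k<..<int k}. F d)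
    = (\<Sum>j<k. F (int j) + F (- int j)) - (if k = 0 then 0 else F 0)"
proof (induction k)
  case (Suc k)
  show ?case
  proof (cases "k = 0")
    case True
    have "{- 1<..<1 :: int} = {0}" by auto
    then show ?thesis using True by simp
  next
    case False
    have "{- int (Suc k)<..<int (Suc k)} = insert (int k) (insert (- int k) {- int k<..<int k})"
      by auto
    then show ?thesis using Suc False by (simp add: algebra_simps)
  qed
qed simp

section \<open>The Hecke algebra operators\<close>

lemma fun_act_u: "fun_act M weyl_u f = (\<lambda>n. f (M - n))"
  by (simp add: fun_act_def inverse_weyl_u act_simps)

lemma fun_act_s: "fun_act M weyl_s f = (\<lambda>n. f (- n))"
  by (simp add: fun_act_def inverse_weyl_s act_simps)

text \<open>Summing in reverse order makes the sums at \<open>k\<close> and \<open>- k\<close> the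
  same up to sign.\<close>

lemma J_op_pos: "J_op f (int k) = - (\<Sum>j<k. f (2 * int j - int k))"
proof -
  have "(\<Sum>j = 1..k. f (int k - 2 * int j)) = (\<Sum>j<k. f (2 * int j - int k))"
    by (rule sum.reindex_bij_witness[of _ "\<lambda>j. k - j" "\<lambda>j. k - j"]) (auto simp: of_nat_diff)
  then show ?thesis by (simp add: J_op_def)
qed

lemma J_op_neg: "J_op f (- int k) = (\<Sum>j<k. f (2 * int j - int k))"
  by (simp add: J_op_def algebra_simps)

lemma int_cases_sign: obtains k where "n = int k" | k where "n = - int k"
  by (metis int_cases2)

lemma J_op_odd: "J_op f (- n) = - J_op f n"
  by (cases n rule: int_cases_sign) (simp_all add: J_op_pos J_op_neg)

text \<open>Adding the missing endpoint completes the string \<open>- k, - k + 2, ..., k\<close>,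
  which negation preserves.\<close>

lemma J_op_reflect: "J_op (\<lambda>n. f (- n)) n = J_op f n + f (- n) - f n"
proof -
  have *: "(\<Sum>j<k. f (int k - 2 * int j)) + f (- int k) = (\<Sum>j<k. f (2 * int j - int k)) + f (int k)"
    for k
  proof -
    have "(\<Sum>j<k. f (int k - 2 * int j)) + f (- int k) = (\<Sum>j<Suc k. f (int k - 2 * int j))"
      by simp
    also have "\<dots> = (\<Sum>j<Suc k. f (2 * int j - int k))"
      by (rule sum.reindex_bij_witness[of _ "\<lambda>j. k - j" "\<lambda>j. k - j"]) (auto simp: of_nat_diff)
    finally show ?thesis by simp
  qed
  show ?thesis
    by (cases n rule: int_cases_sign)
      (use * in \<open>simp_all add: J_op_pos J_op_neg algebra_simps\<close>)
qed

lemma J_op_add: "J_op (\<lambda>n. f n + g n) n = J_op f n + J_op g n"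
  by (simp add: J_op_def sum.distrib)

lemma J_op_scale: "J_op (\<lambda>n. x * f n) n = x * J_op f n"
  by (simp add: J_op_def sum_distrib_left)

text \<open>Since \<open>J f\<close> is odd, \<open>J_op_reflect\<close> applied to it reads
  \<open>- J J f = J J f - 2 J f\<close>.\<close>

lemma J_op_idem: "J_op (J_op f) n = J_op f n"
proof -
  have "J_op (\<lambda>m. J_op f (- m)) n = J_op (J_op f) n + J_op f (- n) - J_op f n"
    by (rule J_op_reflect)
  moreover have "J_op (\<lambda>m. J_op f (- m)) n = - J_op (J_op f) n"
    using J_op_scale[of "- 1" "J_op f" n] by (simp add: J_op_odd)
  ultimately show ?thesis by (simp add: J_op_odd)
qed

text \<open>The strings of the two sides differ by one endpoint, gained for \<open>n >= 0\<close>
  and lost for \<open>n < 0\<close>.\<close>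

lemma J_op_shift:
  "J_op (\<lambda>n. f (n - 1)) n = J_op f (n + 1) + f (n - 1)"
  "J_op (\<lambda>n. f (n + 1)) n = J_op f (n - 1) - f (n - 1)"
proof -
  have pos: "J_op (\<lambda>n. f (n - 1)) (int k) = J_op f (int k + 1) + f (int k - 1)" for k and f :: "int \<Rightarrow> complex"
  proof -
    have "J_op f (int k + 1) = - (\<Sum>j<Suc k. f (2 * int j - int (Suc k)))"
      using J_op_pos[of f "Suc k"] by (simp add: add.commute)
    then show ?thesis
      unfolding J_op_pos by (simp only: sum.lessThan_Suc) (simp add: algebra_simps)
  qed
  have neg: "J_op (\<lambda>n. f (n - 1)) (- int k) = J_op f (- int k + 1) + f (- int k - 1)" for k and f :: "int \<Rightarrow> complex"
  proof (cases k)
    case 0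
    then show ?thesis by (simp add: J_op_def)
  next
    case (Suc l)
    have "J_op f (- int k + 1) = (\<Sum>j<l. f (2 * int j - int l))"
      using J_op_neg[of f l] Suc by simp
    moreover have "(\<Sum>j<k. f (2 * int j - int k - 1)) = f (- int k - 1) + (\<Sum>j<l. f (2 * int j - int l))"
      unfolding Suc sum.lessThan_Suc_shift by (simp add: algebra_simps)
    ultimately show ?thesis
      unfolding J_op_neg by simp
  qed
  show 1: "J_op (\<lambda>n. f (n - 1)) n = J_op f (n + 1) + f (n - 1)" for n and f :: "int \<Rightarrow> complex"
    by (cases n rule: int_cases_sign) (simp_all add: pos neg)
  show "J_op (\<lambda>n. f (n + 1)) n = J_op f (n - 1) - f (n - 1)"
    using 1[of "\<lambda>n. f (n + 1)" "n - 1"] by simp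
qed

section \<open>Quadratic relations and commutation with shifts\<close>

locale hecke_parameters =
  fixes \<tau> :: real and M :: int
  assumes tau_pos: "0 < \<tau>" and M_gt_1: "M > 1"
begin

definition q :: complex where "q = of_real (\<tau> - inverse \<tau>)"

lemma tau_square: "of_real \<tau> * of_real \<tau> = 1 + q * of_real \<tau>"
  using tau_pos by (simp add: q_def algebra_simps flip: of_real_inverse of_real_mult)

lemma I_op_eq: "I_op \<tau> M f n = of_real \<tau> * f (- n) + q * J_op f n"
  by (simp add: I_op_def fun_act_s q_def)

lemma I_op_add: "I_op \<tau> M (\<lambda>n. f n + g n) n = I_op \<tau> M f n + I_op \<tau> M g n"
  by (simp add: I_op_eq J_op_add algebra_simps)

lemma I_op_scale: "I_op \<tau> M (\<lambda>n. x * f n) n = x * I_op \<tau> M f n"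
  by (simp add: I_op_eq J_op_scale algebra_simps)

lemma I_op_quadratic: "I_op \<tau> M (I_op \<tau> M f) n = q * I_op \<tau> M f n + f n"
proof -
  have "I_op \<tau> M f = (\<lambda>n. of_real \<tau> * f (- n) + q * J_op f n)"
    by (simp add: fun_eq_iff I_op_eq)
  then have "I_op \<tau> M (I_op \<tau> M f) n
      = of_real \<tau> * I_op \<tau> M (\<lambda>n. f (- n)) n + q * I_op \<tau> M (J_op f) n"
    using I_op_add[of "\<lambda>n. of_real \<tau> * f (- n)" "\<lambda>n. q * J_op f n" n]
    by (simp add: I_op_scale)
  also have "\<dots> = (of_real \<tau> * of_real \<tau>) * f n + q * of_real \<tau> * (f (- n) - f n) + q * q * J_op f n"
    by (simp add: I_op_eq J_op_reflect J_op_odd J_op_idem algebra_simps)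
  also have "\<dots> = q * I_op \<tau> M f n + f n"
    unfolding tau_square by (simp add: I_op_eq algebra_simps)
  finally show ?thesis .
qed

text \<open>As \<open>I - q\<close> is the inverse of \<open>I\<close>, the first equation says that
  \<open>D\<close> followed by this inverse is \<open>I\<close> followed by the inverse of
  \<open>D\<close>.\<close>

lemma I_op_shift:
  "I_op \<tau> M (\<lambda>n. f (n - 1)) n = I_op \<tau> M f (n + 1) + q * f (n - 1)"
  "I_op \<tau> M (\<lambda>n. f (n + 1)) n = I_op \<tau> M f (n - 1) - q * f (n - 1)"
  by (simp_all add: I_op_eq J_op_shift minus_diff_commute ring_distribs)

abbreviation T :: "nat \<Rightarrow> (int \<Rightarrow> complex) \<Rightarrow> int \<Rightarrow> complex" where
  "T \<equiv> I_refl \<tau> M"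

lemma T_0: "T 0 f n = I_op \<tau> M (\<lambda>n. f (M - n)) (M - n)"
  by (simp add: I_refl_def fun_act_u)

lemma T_1: "T (Suc 0) = I_op \<tau> M"
  by (simp add: I_refl_def)

lemma T_cases: "T i = T 0 \<or> T i = I_op \<tau> M"
  by (simp add: I_refl_def)

lemma T_add: "T i (\<lambda>n. f n + g n) n = T i f n + T i g n"
  by (rule disjE[OF T_cases[of i]]) (simp_all add: T_0 I_op_add)

lemma T_scale: "T i (\<lambda>n. x * f n) n = x * T i f n"
  by (rule disjE[OF T_cases[of i]]) (simp_all add: T_0 I_op_scale)

lemma T_diff: "T i (\<lambda>n. f n - g n) n = T i f n - T i g n"
  using T_add[of i f "\<lambda>n. - 1 * g n" n] T_scale[of i "- 1" g n] by simp

lemma T_sum: "finite F \<Longrightarrow> T i (\<lambda>n. \<Sum>j\<in>F. g j n) n = (\<Sum>j\<in>F. T i (g j) n)"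
proof (induction F rule: finite_induct)
  case empty
  then show ?case using T_scale[of i 0 "\<lambda>_. 0" n] by simp
qed (simp add: T_add)

lemma T_quadratic: "T i (T i f) n = q * T i f n + f n"
proof (rule disjE[OF T_cases[of i]])
  assume i: "T i = T 0"
  have "T 0 (T 0 f) n = I_op \<tau> M (I_op \<tau> M (\<lambda>n. f (M - n))) (M - n)"
    by (simp add: T_0)
  then show ?thesis unfolding i I_op_quadratic by (simp add: T_0)
qed (simp add: I_op_quadratic)

text \<open>\<open>orient i\<close> is the outward direction at the wall of \<open>s\<^sub>i\<close> (the point \<open>M\<close> for \<open>i = 0\<close>, the point \<open>0\<close>
  for \<open>i = 1\<close>) of the fundamental domain \<open>{0..M}\<close>.\<close>

definition orient :: "nat \<Rightarrow> int" where "orient i = (if i = 0 then 1 else - 1)"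

text \<open>Conjugation by \<open>u\<close> exchanges \<open>D\<close> and its inverse;
  \<open>orient\<close> absorbs this, so that one pair of formulas serves both generators.\<close>

lemma T_shift:
  "T i (\<lambda>n. f (n - orient i)) n = T i f (n + orient i) - q * f (n + orient i)"
  "T i (\<lambda>n. f (n + orient i)) n = T i f (n - orient i) + q * f (n + orient i)"
proof -
  let ?g = "\<lambda>n. f (M - n)"
  have "T 0 (\<lambda>n. f (n - 1)) n = I_op \<tau> M (\<lambda>n. ?g (n + 1)) (M - n)"
    and "T 0 (\<lambda>n. f (n + 1)) n = I_op \<tau> M (\<lambda>n. ?g (n - 1)) (M - n)"
    by (simp_all add: T_0 algebra_simps)
  then have 0: "T 0 (\<lambda>n. f (n - 1)) n = T 0 f (n + 1) - q * f (n + 1)"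
     "T 0 (\<lambda>n. f (n + 1)) n = T 0 f (n - 1) + q * f (n + 1)"
    using I_op_shift(2)[of ?g "M - n"] I_op_shift(1)[of ?g "M - n"]
    by (simp_all add: T_0[of f] algebra_simps)
  have *: "i = 0 \<and> orient i = 1 \<or> T i = I_op \<tau> M \<and> orient i = - 1"
    by (simp add: orient_def I_refl_def)
  show "T i (\<lambda>n. f (n - orient i)) n = T i f (n + orient i) - q * f (n + orient i)"
    using * by (auto simp: 0 I_op_shift)
  show "T i (\<lambda>n. f (n + orient i)) n = T i f (n - orient i) + q * f (n + orient i)"
    using * by (auto simp: 0 I_op_shift)
qed

lemma T_at_wall: "T 0 f M = of_real \<tau> * f M" "T 1 f 0 = of_real \<tau> * f 0"
  by (simp_all add: T_0 T_1 I_op_eq J_op_def)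

text \<open>One step inside the wall, \<open>J\<close> consists of a single term, which turns the
  coefficient \<tau> into its inverse.\<close>

lemma T_past_wall: "T 0 f (M - 1) = inverse (of_real \<tau>) * f (M + 1)"
  "T 1 f 1 = inverse (of_real \<tau>) * f (- 1)"
proof -
  have "I_op \<tau> M f 1 = inverse (of_real \<tau>) * f (- 1)" for f
    by (simp add: I_op_eq J_op_def q_def algebra_simps)
  from this[of f] this[of "\<lambda>n. f (M - n)"]
  show "T 0 f (M - 1) = inverse (of_real \<tau>) * f (M + 1)"
    "T 1 f 1 = inverse (of_real \<tau>) * f (- 1)"
    by (simp_all add: T_0 T_1)
qed

definition T_alt :: "nat \<Rightarrow> nat \<Rightarrow> (int \<Rightarrow> complex) \<Rightarrow> int \<Rightarrow> complex" where
  "T_alt b k = foldr (\<circ>) (map T (alt b k)) id"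

lemma T_alt_0 [simp]: "T_alt b 0 f = f"
  by (simp add: T_alt_def)

lemma T_alt_Suc: "T_alt b (Suc k) f = T ((b + k) mod 2) (T_alt b k f)"
  by (simp add: T_alt_def)

lemma foldr_comp: "foldr (\<circ>) fs g = foldr (\<circ>) fs id \<circ> g"
  by (induction fs) (simp_all add: comp_assoc)

text \<open>The relation for \<open>T_hat\<close> needs the rightmost factor, whereas the recursion
  of \<open>alt\<close> exposes the leftmost.\<close>

lemma T_alt_Suc_right: "T_alt 1 (Suc k) f = T_alt 0 k (I_op \<tau> M f)"
  unfolding T_alt_def alt_snoc map_append foldr_append foldr_comp[of "map T (alt 0 k)" "foldr _ _ _"]
  by (simp add: T_1)

lemma I_weyl_alt:
  "b \<in> {0, 1} \<Longrightarrow> I_weyl \<tau> M (prod_list (map simple_refl (alt b k))) = T_alt b k"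
  unfolding I_weyl_def T_alt_def
  by (simp add: reduced_expr_alt fun_eq_iff fun_act_def inverse_weyl_one act_simps)

lemma T_alt_fun_act_u: "T_alt 1 k (fun_act M weyl_u f) = fun_act M weyl_u (T_alt 0 k f)"
proof (induction k)
  case (Suc k)
  have "T 1 (fun_act M weyl_u g) = fun_act M weyl_u (T 0 g)"
       "T 0 (fun_act M weyl_u g) = fun_act M weyl_u (T 1 g)" for g
    by (simp_all add: fun_eq_iff T_0 T_1 fun_act_u)
  moreover have "k mod 2 = 0 \<and> Suc k mod 2 = 1 \<or> k mod 2 = 1 \<and> Suc k mod 2 = 0"
    by presburger
  ultimately show ?case using Suc by (auto simp: T_alt_Suc)
qed simp

section \<open>The coefficients a and the inverse of an alternating product\<close>

definition \<alpha> :: "nat \<Rightarrow> complex" where "\<alpha> k = of_real (a_coeff \<tau> (int k))"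

text \<open>Up to a constant factor the sequence is the difference of the k-th powers of
  \<open>1 / \<tau>\<close> and \<open>- \<tau>\<close>, the roots of
  \<open>x^2 = 1 - q x\<close>.\<close>

lemma alpha_rec: "\<alpha> 0 = 0" "\<alpha> (Suc 0) = - q" "\<alpha> (Suc (Suc k)) = \<alpha> k - q * \<alpha> (Suc k)"
proof -
  have t: "\<tau> \<noteq> 0" "1 + \<tau>\<^sup>2 \<noteq> 0" using tau_pos by (auto simp: add_nonneg_eq_0_iff)
  have a: "a_coeff \<tau> (int k) = (1 - \<tau>\<^sup>2) / (1 + \<tau>\<^sup>2) * (inverse \<tau> ^ k - (- \<tau>) ^ k)" for k
  proof -
    have "(- 1 :: real) powi (int k + 1) = - ((- 1) ^ k)"
      using power_int_of_nat[of "- 1 :: real" "Suc k"] by (simp add: add.commute)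
    moreover have "(- \<tau>) ^ k = (- 1) ^ k * \<tau> ^ k" by (rule power_minus)
    ultimately show ?thesis
      by (simp add: a_coeff_def power_int_minus power_inverse)
  qed
  show "\<alpha> 0 = 0" by (simp add: \<alpha>_def a_coeff_def)
  have "a_coeff \<tau> (int (Suc 0)) = - (\<tau> - inverse \<tau>)"
  proof -
    have "inverse \<tau> + \<tau> = (1 + \<tau>\<^sup>2) * inverse \<tau>"
      using t(1) by (simp add: power2_eq_square field_simps)
    moreover have "(1 - \<tau>\<^sup>2) / (1 + \<tau>\<^sup>2) * ((1 + \<tau>\<^sup>2) * inverse \<tau>) = (1 - \<tau>\<^sup>2) * inverse \<tau>"
      using t(2) by simp
    ultimately show ?thesis
      unfolding a using t(1) by (simp add: power2_eq_square algebra_simps)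
  qed
  then show "\<alpha> (Suc 0) = - q" by (simp add: \<alpha>_def q_def)
  have 1: "inverse \<tau> ^ Suc (Suc k) = inverse \<tau> ^ k - (\<tau> - inverse \<tau>) * inverse \<tau> ^ Suc k"
    and 2: "(- \<tau>) ^ Suc (Suc k) = (- \<tau>) ^ k - (\<tau> - inverse \<tau>) * (- \<tau>) ^ Suc k"
    using t by (simp_all add: algebra_simps)
  have "a_coeff \<tau> (int (Suc (Suc k))) = a_coeff \<tau> (int k) - (\<tau> - inverse \<tau>) * a_coeff \<tau> (int (Suc k))"
    unfolding a 1 2 by (simp only: algebra_simps)
  then show "\<alpha> (Suc (Suc k)) = \<alpha> k - q * \<alpha> (Suc k)"
    by (simp add: \<alpha>_def q_def)
qed

text \<open>The recurrence applies termwise for \<open>j < l\<close>; the two remaining terms use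
  \<open>\<alpha> 2 = q * q\<close> and \<open>\<alpha> 1 = - q\<close>.\<close>

lemma alpha_convolution:
  "(\<Sum>j<Suc (Suc l). \<alpha> (Suc (Suc l) - j) * u j)
   = (\<Sum>j<l. \<alpha> (l - j) * u j) - q * (\<Sum>j<Suc l. \<alpha> (Suc l - j) * u j) - q * u (Suc l)"
proof -
  have "(\<Sum>j<l. \<alpha> (Suc (Suc l) - j) * u j)
      = (\<Sum>j<l. \<alpha> (l - j) * u j - q * (\<alpha> (Suc l - j) * u j))"
  proof (rule sum.cong)
    fix j assume "j \<in> {..<l}"
    then have "Suc (Suc l) - j = Suc (Suc (l - j))" "Suc l - j = Suc (l - j)" by auto
    then show "\<alpha> (Suc (Suc l) - j) * u j = \<alpha> (l - j) * u j - q * (\<alpha> (Suc l - j) * u j)"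
      by (simp add: alpha_rec algebra_simps)
  qed simp
  moreover have "Suc (Suc l) - l = 2" "Suc (Suc l) - Suc l = Suc 0" "Suc l - l = Suc 0"
    by auto
  moreover have "\<alpha> 2 = q * q"
    using alpha_rec(3)[of 0] by (simp add: alpha_rec numeral_2_eq_2)
  ultimately show ?thesis
    by (simp add: alpha_rec sum_subtractf sum_distrib_left algebra_simps)
qed

text \<open>The scalar identity behind \<open>S_Suc\<close>: \<open>u j\<close> and
  \<open>v j\<close> stand for the two alternating words of length \<open>j\<close>, and
  \<open>w j\<close> for \<open>v j\<close> after multiplication by the new letter.\<close>

lemma alpha_sum_step:
  assumes "u 0 = v 0" "w 0 = v 1" "\<And>j. w (Suc j) = u j + q * v (Suc j)"
  shows "(\<Sum>j<Suc k. \<alpha> (Suc k - j) * (u j + v j)) - \<alpha> (Suc k) * u 0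
    = ((\<Sum>j<k. \<alpha> (k - j) * (v (Suc j) + w j)) - \<alpha> k * v 1)
      - q * ((\<Sum>j<k. \<alpha> (k - j) * (u j + v j)) - \<alpha> k * u 0) - q * u k"
proof (cases k)
  case 0
  then show ?thesis using assms(1) by (simp add: alpha_rec)
next
  case (Suc l)
  have v1: "(\<Sum>j<Suc (Suc l). \<alpha> (Suc (Suc l) - j) * v j)
      = \<alpha> (Suc (Suc l)) * u 0 + (\<Sum>j<Suc l. \<alpha> (Suc l - j) * v (Suc j))"
    using assms(1) by (simp add: sum.lessThan_Suc_shift del: sum.lessThan_Suc)
  have v2: "(\<Sum>j<Suc l. \<alpha> (Suc l - j) * v j) = \<alpha> (Suc l) * u 0 + (\<Sum>j<l. \<alpha> (l - j) * v (Suc j))"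
    using assms(1) by (simp add: sum.lessThan_Suc_shift del: sum.lessThan_Suc)
  have w: "(\<Sum>j<Suc l. \<alpha> (Suc l - j) * w j)
      = \<alpha> (Suc l) * v 1 + (\<Sum>j<l. \<alpha> (l - j) * u j) + q * (\<Sum>j<l. \<alpha> (l - j) * v (Suc j))"
    using assms(2,3)
    by (simp add: sum.lessThan_Suc_shift sum.distrib sum_distrib_left algebra_simps del: sum.lessThan_Suc)
  show ?thesis
    unfolding Suc distrib_left sum.distrib v1 v2 w alpha_convolution[of l u]
    by (simp add: algebra_simps del: sum.lessThan_Suc)
qed

text \<open>\<open>T_alt b k f + S k f\<close> is the inverse of the operator of the reversed alternating word, applied to \<open>f\<close>.
  The last term of \<open>S\<close> corrects the double count of the empty word at \<open>j = 0\<close>.\<close>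

definition S :: "nat \<Rightarrow> (int \<Rightarrow> complex) \<Rightarrow> int \<Rightarrow> complex" where
  "S k f n = (\<Sum>j<k. \<alpha> (k - j) * (T_alt 0 j f n + T_alt 1 j f n)) - \<alpha> k * f n"

text \<open>Multiplying the inverse \<open>T_alt b k f + S k f\<close> by \<open>T - q\<close>, the
  inverse of \<open>T\<close>, must give the same expression for \<open>Suc k\<close>. Both kinds of
  shorter words enter \<open>S\<close>, so it does not depend on \<open>b\<close>.\<close>

lemma S_Suc:
  assumes b: "b \<in> {0, 1}"
  shows "S (Suc k) f n = T ((b + k) mod 2) (S k f) n - q * S k f n - q * T_alt b k f n"
proof -
  \<comment> \<open>The parities are chosen so that, for \<open>j > 0\<close>, the word of
    \<open>v j\<close> begins with the new letter and that of \<open>u j\<close> with the other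
    one.\<close>
  define u where "u j = T_alt ((b + k + j) mod 2) j f" for j
  define v where "v j = T_alt ((b + k + j + 1) mod 2) j f" for j
  let ?T = "T ((b + k) mod 2)"
  have uv: "T_alt 0 j f n + T_alt 1 j f n = u j n + v j n" for j n
  proof -
    have "(b + k + j) mod 2 = 0 \<and> (b + k + j + 1) mod 2 = 1
        \<or> (b + k + j) mod 2 = 1 \<and> (b + k + j + 1) mod 2 = 0"
      by presburger
    then show ?thesis unfolding u_def v_def by (elim disjE) simp_all
  qed
  have S: "S k f n = (\<Sum>j<k. \<alpha> (k - j) * (u j n + v j n)) - \<alpha> k * u 0 n" for k n
    unfolding S_def uv by (simp add: u_def)
  have Tu: "?T (u j) = v (Suc j)" for j
  proof -
    have "((b + k + j) mod 2 + j) mod 2 = (b + k) mod 2" by presburger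
    then show ?thesis by (simp add: u_def v_def T_alt_Suc)
  qed
  have Tv: "?T (v (Suc j)) n = u j n + q * v (Suc j) n" for j n
    unfolding Tu[symmetric] T_quadratic by simp
  have "?T (S k f) n = ?T (\<lambda>n. (\<Sum>j<k. \<alpha> (k - j) * (u j n + v j n)) - \<alpha> k * u 0 n) n"
    by (simp add: S[abs_def])
  also have "\<dots> = (\<Sum>j<k. \<alpha> (k - j) * (v (Suc j) n + ?T (v j) n)) - \<alpha> k * v 1 n"
    by (simp add: T_diff T_sum T_scale T_add Tu)
  finally have TS: "?T (S k f) n = \<dots>" .
  have uk: "T_alt b k f = u k"
  proof -
    have "(b + k + k) mod 2 = b" using b by (auto; presburger)
    then show ?thesis by (simp add: u_def)
  qed
  show ?thesis
    unfolding TS uk S[of k] S[of "Suc k"]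
  proof (rule alpha_sum_step)
    show "u 0 n = v 0 n" by (simp add: u_def v_def)
    show "?T (v 0) n = v 1 n" unfolding One_nat_def Tu[symmetric] by (simp add: u_def v_def)
  qed (rule Tv)
qed

section \<open>Moving D through alternating products\<close>

lemma orient_next: "orient ((b + Suc k) mod 2) = - orient ((b + k) mod 2)"
  by (auto simp: orient_def mod_Suc)

lemma T_alt_0_shift:
  "T_alt 0 k (D_op f) n = (let e = orient (k mod 2) in T_alt 0 k f (n - e) + S k f (n - e))"
proof (induction k arbitrary: n)
  case 0
  show ?case by (simp add: S_def alpha_rec orient_def D_op_def)
next
  case (Suc k)
  let ?i = "k mod 2"
  have "T_alt 0 (Suc k) (D_op f) n = T ?i (T_alt 0 k (D_op f)) n"
    by (simp add: T_alt_Suc)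
  also have "T_alt 0 k (D_op f) = (\<lambda>n. T_alt 0 k f (n - orient ?i) + S k f (n - orient ?i))"
    using Suc by (simp add: fun_eq_iff Let_def)
  also have "T ?i \<dots> n = T_alt 0 (Suc k) f (n + orient ?i) + S (Suc k) f (n + orient ?i)"
    using S_Suc[of 0 k f] by (simp add: T_add T_shift T_alt_Suc)
  finally show ?case using orient_next[of 0 k] by (simp add: Let_def)
qed

text \<open>Here the shift starts in the other direction, so the second rule of
  \<open>T_shift\<close> applies to the main term. Its extra \<open>q\<close> term stays on the
  opposite side of \<open>n\<close> and joins the correction \<open>S\<close>.\<close>

lemma T_alt_1_shift:
  "T_alt 1 k (D_op f) n = (let e = orient (Suc k mod 2) in T_alt 1 k f (n + e) - S k f (n - e))"
proof (induction k arbitrary: n)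
  case 0
  show ?case by (simp add: S_def alpha_rec orient_def D_op_def)
next
  case (Suc k)
  let ?i = "Suc k mod 2"
  have "T_alt 1 (Suc k) (D_op f) n = T ?i (T_alt 1 k (D_op f)) n"
    by (simp add: T_alt_Suc)
  also have "T_alt 1 k (D_op f) = (\<lambda>n. T_alt 1 k f (n + orient ?i) - S k f (n - orient ?i))"
    using Suc by (simp add: fun_eq_iff Let_def)
  also have "T ?i \<dots> n = T_alt 1 (Suc k) f (n - orient ?i) - S (Suc k) f (n + orient ?i)"
    using S_Suc[of 1 k f] by (simp add: T_diff T_shift T_alt_Suc)
  finally show ?case using orient_next[of 1 k] by (simp add: Let_def)
qed

section \<open>The intertwiner\<close>

lemma M_pos: "M > 0"
  using M_gt_1 by simp

definition T_chamber :: "int \<Rightarrow> (int \<Rightarrow> complex) \<Rightarrow> int \<Rightarrow> complex" where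
  "T_chamber c = T_alt (if c \<ge> 0 then 0 else 1) (nat \<bar>c\<bar>)"

lemma T_chamber_int: "T_chamber (int k) = T_alt 0 k" "T_chamber (- int k) = T_alt 1 k"
  by (auto simp: T_chamber_def fun_eq_iff)

lemma intertwiner_chamber:
  "intertwiner \<tau> M f n = of_real (\<tau> powi (- \<bar>chamber M n\<bar>))
     * T_chamber (chamber M n) f (act M (chamber_elt (chamber M n)) n)"
proof -
  have "I_weyl \<tau> M (chamber_elt c) = T_chamber c" for c
    unfolding chamber_elt_def T_chamber_def by (rule I_weyl_alt) simp
  then show ?thesis
    by (simp add: intertwiner_def shortest_to_dom_eq[OF M_pos] weyl_length_chamber_elt dom_rep_def Let_def)
qed

lemma tau_powi_Suc: "\<tau> powi (- (int k + 1)) = \<tau> powi (- int k) * inverse \<tau>"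
  using power_int_add[of \<tau> "- int k" "- 1"] tau_pos by (simp add: power_int_minus)

text \<open>On a wall, passing to the farther of the two adjacent chambers multiplies the operator by \<open>\<tau>\<close>, which
  cancels against the prefactor.\<close>

lemma intertwiner_at:
  assumes "d * M \<le> n" "n \<le> (d + 1) * M"
  shows "intertwiner \<tau> M f n
    = of_real (\<tau> powi (- \<bar>d\<bar>)) * T_chamber d f (act M (chamber_elt d) n)"
proof (cases "d = chamber M n")
  case True
  then show ?thesis by (simp add: intertwiner_chamber)
next
  case False
  from wall_cases[OF M_pos assms False] show ?thesis
  proof cases
    case 1
    define k where "k = nat (d - 1)"
    have d: "d = int (Suc k)" and c: "chamber M n = int k" using 1 by (simp_all add: k_def)
    have "T (k mod 2) g (act M (chamber_elt d) n) = of_real \<tau> * g (act M (chamber_elt (int k)) n)" for g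
      using T_at_wall[of g] 1(2)
      by (cases "even k") (auto simp: d act_chamber_elt algebra_simps mod2_eq_if)
    then have "T_chamber d f (act M (chamber_elt d) n)
        = of_real \<tau> * T_chamber (int k) f (act M (chamber_elt (int k)) n)"
      unfolding d T_chamber_int by (simp add: T_alt_Suc)
    then show ?thesis
      using tau_pos tau_powi_Suc[of k] by (simp add: intertwiner_chamber c d add.commute)
  next
    case 2
    define k where "k = nat (- d - 1)"
    have d: "d = - int (Suc k)" and c: "chamber M n = - int k" using 2 by (simp_all add: k_def)
    have "T (Suc k mod 2) g (act M (chamber_elt d) n) = of_real \<tau> * g (act M (chamber_elt (- int k)) n)" for g
      using T_at_wall[of g] 2(2)
      by (cases "even k") (auto simp: d act_chamber_elt algebra_simps mod2_eq_if)
    then have "T_chamber d f (act M (chamber_elt d) n)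
        = of_real \<tau> * T_chamber (- int k) f (act M (chamber_elt (- int k)) n)"
      unfolding d T_chamber_int by (simp add: T_alt_Suc)
    then show ?thesis
      using tau_pos tau_powi_Suc[of k] by (simp add: intertwiner_chamber c d add.commute)
  qed
qed

section \<open>The relation for X_hat\<close>

lemma S_eq_sum_chambers:
  "S k f n = (\<Sum>d\<in>{- int k<..<int k}. \<alpha> (k - nat \<bar>d\<bar>) * T_chamber d f n)"
  unfolding S_def sum_symmetric_interval
  by (simp add: T_chamber_int T_chamber_int(1)[of 0, simplified] distrib_left alpha_rec)

lemma X_hat_sum:
  assumes m: "m \<in> {0..M}"
  shows "(\<Sum>v | weyl_less v (chamber_elt c).
      of_real (\<tau> powi (- (\<bar>c\<bar> - int (weyl_length v))) * a_coeff \<tau> (\<bar>c\<bar> - int (weyl_length v)))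
        * intertwiner \<tau> M f (act M v m))
    = of_real (\<tau> powi (- \<bar>c\<bar>)) * S (nat \<bar>c\<bar>) f m"
proof -
  let ?D = "{- \<bar>c\<bar> <..< \<bar>c\<bar>}" and ?i = "\<lambda>d. inverse (chamber_elt d)"
  \<comment> \<open>Reindexing by inverses is possible as inversion preserves length; it is useful
    because the inverse of \<open>chamber_elt d\<close> sends \<open>m\<close> into the chamber
    \<open>d\<close>, where the intertwiner involves \<open>T_chamber d\<close>.\<close>
  have "chamber_elt ` ?D = ?i ` ?D"
    unfolding inverse_chamber_elt
  proof (intro equalityI subsetI)
    fix v assume "v \<in> chamber_elt ` ?D"
    then obtain d where d: "d \<in> ?D" "v = chamber_elt d" by blast
    then show "v \<in> (\<lambda>d. chamber_elt (if even d then - d else d)) ` ?D"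
      by (intro image_eqI[of _ _ "if even d then - d else d"]) auto
  qed auto
  then have less: "{v. weyl_less v (chamber_elt c)} = ?i ` ?D"
    by (simp add: weyl_less_chamber_elt)
  have inj: "inj_on ?i ?D"
    by (rule inj_onI) (metis injD inj_chamber_elt inverse_inverse_weyl)
  have "(\<Sum>v | weyl_less v (chamber_elt c).
      of_real (\<tau> powi (- (\<bar>c\<bar> - int (weyl_length v))) * a_coeff \<tau> (\<bar>c\<bar> - int (weyl_length v)))
        * intertwiner \<tau> M f (act M v m))
    = (\<Sum>d\<in>?D. of_real (\<tau> powi (- \<bar>c\<bar>)) * (\<alpha> (nat (\<bar>c\<bar>) - nat (\<bar>d\<bar>)) * T_chamber d f m))"
    unfolding less sum.reindex[OF inj] o_def
  proof (rule sum.cong)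
    fix d assume d: "d \<in> ?D"
    have len: "weyl_length (?i d) = nat \<bar>d\<bar>"
      by (simp add: inverse_chamber_elt weyl_length_chamber_elt)
    have at: "intertwiner \<tau> M f (act M (?i d) m) = of_real (\<tau> powi (- \<bar>d\<bar>)) * T_chamber d f m"
      using intertwiner_at[of d "act M (?i d) m" f] m
        act_chamber_elt_in_dom_iff[of M d "act M (?i d) m"] by (simp add: act_inverse)
    have nat: "int (nat (\<bar>c\<bar>) - nat (\<bar>d\<bar>)) = \<bar>c\<bar> - \<bar>d\<bar>" using d by auto
    have "\<tau> powi (- (\<bar>c\<bar> - \<bar>d\<bar>)) * \<tau> powi (- \<bar>d\<bar>) = \<tau> powi (- \<bar>c\<bar>)"
      using tau_pos by (simp flip: power_int_add)
    then have pow: "of_real (\<tau> powi (- (\<bar>c\<bar> - \<bar>d\<bar>))) * of_real (\<tau> powi (- \<bar>d\<bar>))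
        = (of_real (\<tau> powi (- \<bar>c\<bar>)) :: complex)"
      by (simp only: flip: of_real_mult)
    show "of_real (\<tau> powi (- (\<bar>c\<bar> - int (weyl_length (?i d))))
          * a_coeff \<tau> (\<bar>c\<bar> - int (weyl_length (?i d)))) * intertwiner \<tau> M f (act M (?i d) m)
      = of_real (\<tau> powi (- \<bar>c\<bar>)) * (\<alpha> (nat (\<bar>c\<bar>) - nat (\<bar>d\<bar>)) * T_chamber d f m)"
      unfolding len at \<alpha>_def nat pow[symmetric] of_real_mult
      by (simp only: int_nat_eq abs_ge_zero if_True mult_ac)
  qed simp
  also have "\<dots> = of_real (\<tau> powi (- \<bar>c\<bar>)) * S (nat \<bar>c\<bar>) f m"
    by (simp add: S_eq_sum_chambers sum_distrib_left)
  finally show ?thesis .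
qed

text \<open>The point \<open>M - n\<close> lies in the chamber \<open>- c\<close>, so
  \<open>1 + eta\<close> is 2 for \<open>c <= 0\<close> and 0 otherwise. Moving from
  \<open>n\<close> by \<open>sgn n\<close> towards the origin does not leave the closed chamber
  \<open>c\<close>.\<close>

lemma X_hat_intertwiner_eq:
  assumes c: "c = chamber M n" and m: "m = act M (chamber_elt c) (n - sgn n)"
  shows "X_hat \<tau> M (intertwiner \<tau> M f) n
    = of_real (\<tau> powi ((\<bar>chamber M (n - 1)\<bar> - \<bar>c\<bar>) * (if c \<le> 0 then 2 else 0)))
        * intertwiner \<tau> M f (n - 1)
      + of_int (sgn n) * (of_real (\<tau> powi (- \<bar>c\<bar>)) * S (nat \<bar>c\<bar>) f m)"
proof -
  have "c * M \<le> n - sgn n \<and> n - sgn n \<le> (c + 1) * M"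
  proof (cases n "0 :: int" rule: linorder_cases)
    case less
    then show ?thesis using chamber_bounds(2)[OF M_pos, of n] by (simp add: c)
  next
    case equal
    then show ?thesis using M_pos by (simp add: c chamber_def)
  next
    case greater
    then show ?thesis using chamber_bounds(1)[OF M_pos, of n] by (simp add: c)
  qed
  then have "m \<in> {0..M}" and rep: "dom_rep M (n - sgn n) = m"
    unfolding m using act_chamber_elt_in_dom_iff dom_rep_eq[OF M_pos] by blast+
  note sum = X_hat_sum[OF this(1), of c f]
  show ?thesis
    unfolding X_hat_def Let_def shortest_to_dom_eq[OF M_pos] act_simps chamber_reflect[OF M_pos]
      eta_chamber_elt weyl_length_chamber_elt rep c[symmetric]
    using sum by simp
qed

lemma act_chamber_elt_step:
  "act M (chamber_elt c) (n - 1) = act M (chamber_elt c) n - (if even c then 1 else - 1)"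
  "act M (chamber_elt c) (n + 1) = act M (chamber_elt c) n + (if even c then 1 else - 1)"
  by (simp_all add: act_chamber_elt)

lemma X_hat_intertwiner_pos:
  assumes "n > 0"
  shows "X_hat \<tau> M (intertwiner \<tau> M f) n = intertwiner \<tau> M (D_op f) n"
proof -
  let ?c = "chamber M n"
  define k where "k = nat ?c"
  note bounds = chamber_bounds(1)[OF M_pos assms]
  have c: "?c = int k" using bounds by (simp add: k_def)
  let ?m = "act M (chamber_elt (int k)) (n - 1)"
  \<comment> \<open>For a positive chamber the \<open>eta\<close> factor vanishes; in chamber 0 the
    points \<open>n\<close> and \<open>n - 1\<close> share their chamber.\<close>
  have exponent: "(\<bar>chamber M (n - 1)\<bar> - \<bar>?c\<bar>) * (if ?c \<le> 0 then 2 else 0) = 0"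
  proof (cases "?c = chamber M (n - 1)")
    case False
    have "?c * M \<le> n - 1" "n - 1 \<le> (?c + 1) * M" using bounds by auto
    from wall_cases[OF M_pos this False] show ?thesis using bounds by cases auto
  qed simp
  have "intertwiner \<tau> M f (n - 1) = of_real (\<tau> powi (- int k)) * T_alt 0 k f ?m"
    using intertwiner_at[of "int k" "n - 1" f] bounds by (simp add: c T_chamber_int)
  then have "X_hat \<tau> M (intertwiner \<tau> M f) n
      = of_real (\<tau> powi (- int k)) * (T_alt 0 k f ?m + S k f ?m)"
    using assms X_hat_intertwiner_eq[OF HOL.refl HOL.refl, of f n] unfolding exponent
    by (simp add: c algebra_simps)
  also have "?m = act M (chamber_elt (int k)) n - orient (k mod 2)"
    by (auto simp: act_chamber_elt_step orient_def mod2_eq_if)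
  then have "T_alt 0 k f ?m + S k f ?m = T_alt 0 k (D_op f) (act M (chamber_elt (int k)) n)"
    by (simp add: T_alt_0_shift Let_def)
  finally show ?thesis by (simp add: intertwiner_chamber[of "D_op f"] c T_chamber_int)
qed

lemma intertwiner_before:
  assumes "n \<le> 0" "chamber M n = - int k"
  shows "of_real (\<tau> powi ((\<bar>chamber M (n - 1)\<bar> - int k) * 2)) * intertwiner \<tau> M f (n - 1)
    = of_real (\<tau> powi (- int k)) * T_alt 1 k f (act M (chamber_elt (- int k)) (n - 1))"
proof -
  let ?c = "- int k :: int"
  have bounds: "?c * M \<le> n" "n < (?c + 1) * M"
    using chamber_bounds(2)[OF M_pos assms(1)] assms(2) by auto
  show ?thesis
  proof (cases "n = ?c * M")
    case False
    then have 1: "?c * M \<le> n - 1" "n - 1 \<le> (?c + 1) * M" using bounds by auto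
    have "?c = chamber M (n - 1)"
    proof (rule ccontr)
      assume "?c \<noteq> chamber M (n - 1)"
      from wall_cases[OF M_pos 1 this] show False using bounds by cases auto
    qed
    then show ?thesis using intertwiner_at[OF 1, of f] by (simp add: T_chamber_int flip: \<open>?c = _\<close>)
  next
    \<comment> \<open>Crossing the left wall costs one \<open>inverse \<tau>\<close> in the
      prefactor and one from \<open>T_past_wall\<close>; the square of \<tau> in
      \<open>X_hat\<close> restores both.\<close>
    case True
    let ?d = "- int (Suc k) :: int"
    have d: "chamber M (n - 1) = ?d"
      using M_pos by (intro chamber_eqI) (auto simp: True algebra_simps)
    have past: "T ((1 + k) mod 2) g (act M (chamber_elt ?d) (n - 1))
        = inverse (of_real \<tau>) * g (act M (chamber_elt ?c) (n - 1))" for g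
      using T_past_wall[of g]
      by (cases "even k") (auto simp: True act_chamber_elt algebra_simps mod2_eq_if)
    have "\<bar>?d\<bar> = int (Suc k)" by simp
    then have "intertwiner \<tau> M f (n - 1) = of_real (\<tau> powi (- int (Suc k)) * inverse \<tau>)
        * T_alt 1 k f (act M (chamber_elt ?c) (n - 1))"
      unfolding intertwiner_chamber d T_chamber_int T_alt_Suc past
      by (simp only: of_real_mult of_real_inverse mult_ac)
    moreover have "\<tau> powi ((\<bar>?d\<bar> - int k) * 2) * (\<tau> powi (- int (Suc k)) * inverse \<tau>) = \<tau> powi (- int k)"
      using tau_pos tau_powi_Suc[of k] by (simp add: add.commute power2_eq_square field_simps)
    ultimately show ?thesis
      unfolding d by (simp only: mult.assoc[symmetric] flip: of_real_mult)
  qed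
qed

lemma X_hat_intertwiner_nonpos:
  assumes "n \<le> 0"
  shows "X_hat \<tau> M (intertwiner \<tau> M f) n = intertwiner \<tau> M (D_op f) n"
proof -
  let ?c = "chamber M n"
  define k where "k = nat (- ?c)"
  have c: "?c = - int k" using chamber_bounds(2)[OF M_pos assms] by (simp add: k_def)
  let ?a = "\<lambda>n. act M (chamber_elt (- int k)) n"
  \<comment> \<open>At \<open>n = 0\<close> the sign vanishes, but so does \<open>S\<close>, since
    then \<open>k = 0\<close>.\<close>
  have sgn: "of_int (sgn n) * S k f (?a (n - sgn n)) = - S k f (?a (n + 1))"
  proof (cases "n = 0")
    case True
    then have "k = 0" by (simp add: k_def chamber_def)
    then show ?thesis using True by (simp add: S_def alpha_rec)
  qed (use assms in simp)
  have "X_hat \<tau> M (intertwiner \<tau> M f) n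
      = of_real (\<tau> powi ((\<bar>chamber M (n - 1)\<bar> - int k) * 2)) * intertwiner \<tau> M f (n - 1)
        + of_real (\<tau> powi (- int k)) * (of_int (sgn n) * S k f (?a (n - sgn n)))"
    using X_hat_intertwiner_eq[OF HOL.refl HOL.refl, of f n] by (simp add: c)
  also have "\<dots> = of_real (\<tau> powi (- int k)) * (T_alt 1 k f (?a (n - 1)) - S k f (?a (n + 1)))"
    unfolding sgn intertwiner_before[OF assms c] by (simp add: algebra_simps)
  also have "?a (n - 1) = ?a n + orient (Suc k mod 2)"
    by (auto simp: act_chamber_elt_step orient_def mod_Suc)
  also have "?a (n + 1) = ?a n - orient (Suc k mod 2)"
    by (auto simp: act_chamber_elt_step orient_def mod_Suc)
  also have "T_alt 1 k f (?a n + orient (Suc k mod 2)) - S k f (?a n - orient (Suc k mod 2))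
      = T_alt 1 k (D_op f) (?a n)"
    unfolding T_alt_1_shift Let_def ..
  finally show ?thesis by (simp add: intertwiner_chamber[of "D_op f"] c T_chamber_int)
qed

section \<open>The relations for u and T_hat\<close>

lemma u_intertwiner:
  "fun_act M weyl_u (intertwiner \<tau> M f) n = intertwiner \<tau> M (fun_act M weyl_u f) n"
proof -
  let ?c = "chamber M n"
  have uu: "fun_act M weyl_u (fun_act M weyl_u f) = f" for f
    by (simp add: fun_act_u)
  have "T_chamber (- ?c) f m = T_chamber ?c (fun_act M weyl_u f) (M - m)" for m
  proof (cases ?c rule: int_cases_sign)
    case (1 k)
    show ?thesis
      using T_alt_fun_act_u[of k "fun_act M weyl_u f"]
      by (simp only: 1 T_chamber_int uu) (simp add: fun_act_u)
  next
    case (2 k)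
    show ?thesis
      by (simp only: 2 minus_minus T_chamber_int T_alt_fun_act_u) (simp add: fun_act_u)
  qed
  moreover have "M - act M (chamber_elt (- ?c)) (M - n) = act M (chamber_elt ?c) n"
    by (simp add: act_chamber_elt algebra_simps)
  ultimately show ?thesis
    by (simp add: fun_act_u[of M "intertwiner \<tau> M f"] intertwiner_chamber chamber_reflect[OF M_pos])
qed

text \<open>For \<open>n > 0\<close> the shortest element at \<open>- n\<close> is the one at
  \<open>n\<close> times \<open>s\<close> on the right and longer by one, whence the extra factor
  \<open>I\<close> and the power of \<tau>.\<close>

lemma intertwiner_minus:
  assumes "n > 0"
  shows "intertwiner \<tau> M (I_op \<tau> M f) n = of_real \<tau> * intertwiner \<tau> M f (- n)"
proof -
  let ?c = "chamber M n"
  define k where "k = nat ?c"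
  have c: "?c = int k" using chamber_bounds(1)[OF M_pos assms] by (simp add: k_def)
  have c': "chamber M (- n) = - int (Suc k)"
    using chamber_minus[OF M_pos, of n] assms c by simp
  have "act M (chamber_elt (- int (Suc k))) (- n) = act M (chamber_elt (int k)) n"
    by (auto simp: act_chamber_elt algebra_simps)
  then show ?thesis
    using tau_pos tau_powi_Suc[of k]
    unfolding intertwiner_chamber c c' T_chamber_int T_alt_Suc_right
    by (simp add: add.commute)
qed

lemma intertwiner_I_I:
  "intertwiner \<tau> M (I_op \<tau> M (I_op \<tau> M f)) n = q * intertwiner \<tau> M (I_op \<tau> M f) n + intertwiner \<tau> M f n"
proof -
  have add: "T_alt b k (\<lambda>n. x * f n + g n) = (\<lambda>n. x * T_alt b k f n + T_alt b k g n)" for b k x f g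
  proof (induction k)
    case (Suc k)
    show ?case unfolding T_alt_Suc Suc by (simp add: fun_eq_iff T_add T_scale)
  qed simp
  have I_I: "I_op \<tau> M (I_op \<tau> M f) = (\<lambda>n. q * I_op \<tau> M f n + f n)"
    by (simp add: fun_eq_iff I_op_quadratic)
  show ?thesis
    unfolding intertwiner_chamber T_chamber_def I_I add by (simp add: algebra_simps)
qed

lemma T_hat_intertwiner: "T_hat \<tau> (intertwiner \<tau> M f) n = intertwiner \<tau> M (I_op \<tau> M f) n"
proof (cases n "0 :: int" rule: linorder_cases)
  case greater
  then show ?thesis by (simp add: T_hat_def intertwiner_minus)
next
  case equal
  then show ?thesis
    by (simp add: T_hat_def intertwiner_chamber chamber_def T_chamber_def act_chamber_elt I_op_eq J_op_def)
next
  case less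
  then have "- n > 0" by simp
  have 1: "of_real \<tau> * intertwiner \<tau> M f n = intertwiner \<tau> M (I_op \<tau> M f) (- n)"
    using intertwiner_minus[OF \<open>- n > 0\<close>, of f] by simp
  \<comment> \<open>The same relation for \<open>I f\<close>; the quadratic relation then removes
    the double \<open>I\<close>.\<close>
  have 2: "of_real \<tau> * intertwiner \<tau> M (I_op \<tau> M f) n
      = q * intertwiner \<tau> M (I_op \<tau> M f) (- n) + intertwiner \<tau> M f (- n)"
    using intertwiner_minus[OF \<open>- n > 0\<close>, of "I_op \<tau> M f"] by (simp add: intertwiner_I_I)
  have "of_real \<tau> * T_hat \<tau> (intertwiner \<tau> M f) n
      = intertwiner \<tau> M f (- n) + q * (of_real \<tau> * intertwiner \<tau> M f n)"
    using less tau_pos by (simp add: T_hat_def q_def algebra_simps)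
  also have "\<dots> = of_real \<tau> * intertwiner \<tau> M (I_op \<tau> M f) n"
    unfolding 1 2 by simp
  finally show ?thesis using tau_pos by simp
qed

end

theorem proposition4p2:
  fixes \<tau> :: real and M :: int
  assumes "0 < \<tau>" and "\<tau> < 1" and "M > 1"
  shows "T_hat \<tau> \<circ> intertwiner \<tau> M = intertwiner \<tau> M \<circ> I_op \<tau> M
    \<and> fun_act M weyl_u \<circ> intertwiner \<tau> M = intertwiner \<tau> M \<circ> fun_act M weyl_u
    \<and> X_hat \<tau> M \<circ> intertwiner \<tau> M = intertwiner \<tau> M \<circ> D_op"
proof -
  interpret hecke_parameters \<tau> M
    using assms by unfold_locales
  have "X_hat \<tau> M (intertwiner \<tau> M f) n = intertwiner \<tau> M (D_op f) n" for f n
    using X_hat_intertwiner_pos X_hat_intertwiner_nonpos by (cases "n > 0") auto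
  then show ?thesis
    by (simp add: fun_eq_iff T_hat_intertwiner u_intertwiner)
qed

end
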